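(* Let $(\theta_1,\dots,\theta_n)\in b\mathbf{\Theta}_n$. Then $$(\alpha^m+\theta_1,\ \alpha^m\theta_1+\theta_2,\ \dots,\ \alpha^m\theta_{n-2}+\theta_{n-1},\ \alpha^m\theta_{n-1}+\theta_n^p,\ \alpha^{m/p}\theta_n)\in b\mathbf{\Theta}_{n+1}$$ for every $\alpha\in\mathbb T$.
   Context: $\mathbb D$ is the open unit disc, $\mathbb T$ the unit circle. Fix positive integers $m,p$ with $p$ dividing $m$, and $n\ge2$. For each $d\ge2$ let $s_i$ be the $i$-th elementary symmetric polynomial in $d$ variables, define $\theta^{(d)}:\mathbb C^d\to\mathbb C^d$ by $\theta^{(d)}(z)=\big(s_1(z_1^m,\dots,z_d^m),\dots,s_{d-1}(z_1^m,\dots,z_d^m),(z_1\cdots z_d)^{m/p}\big)$, and set $\mathbf{\Theta}_d=\theta^{(d)}(\mathbb D^d)$, $\overline{\mathbf{\Theta}}_d=\theta^{(d)}(\overline{\mathbb D}^d)$ (same $m,p$ for all $d$). The distinguished boundary $b\mathbf{\Theta}_d$ is the Shilov boundary of $\overline{\mathbf{\Theta}}_d$, i.e. the smallest closed subset of $\overline{\mathbf{\Theta}}_d$ on which every function continuous on $\overline{\mathbf{\Theta}}_d$ and holomorphic in $\mathbf{\Theta}_d$ attains its maximum modulus (it is known to equal $\theta^{(d)}(\mathbb T^d)$). *)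

theory Defs
  imports "HOL-Analysis.Analysis"
begin

text \<open>
  A vector in \<open>\<complex>\<^sup>d\<close> is a function in \<open>{1..d} \<rightarrow>\<^sub>E UNIV\<close>, the \<open>i\<close>-th coordinate of \<open>z\<close> being \<open>z i\<close>.
  On this set the topology of the type \<open>nat \<Rightarrow> complex\<close> (the product topology) induces the
  Euclidean topology of \<open>\<complex>\<^sup>d\<close>.
\<close>

definition esym :: "nat \<Rightarrow> nat \<Rightarrow> (nat \<Rightarrow> complex) \<Rightarrow> complex" where
  "esym d i z = (\<Sum>S | S \<subseteq> {1..d} \<and> card S = i. \<Prod>j\<in>S. z j)"

definition theta :: "nat \<Rightarrow> nat \<Rightarrow> nat \<Rightarrow> (nat \<Rightarrow> complex) \<Rightarrow> nat \<Rightarrow> complex" where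
  "theta m p d z =
     (\<lambda>i\<in>{1..d}. if i < d then esym d i (\<lambda>j. z j ^ m) else (\<Prod>j=1..d. z j) ^ (m div p))"

definition Theta :: "nat \<Rightarrow> nat \<Rightarrow> nat \<Rightarrow> (nat \<Rightarrow> complex) set" where
  "Theta m p d = theta m p d ` ({1..d} \<rightarrow>\<^sub>E ball 0 1)"

definition cl_Theta :: "nat \<Rightarrow> nat \<Rightarrow> nat \<Rightarrow> (nat \<Rightarrow> complex) set" where
  "cl_Theta m p d = theta m p d ` ({1..d} \<rightarrow>\<^sub>E cball 0 1)"

text \<open>
  Holomorphy in \<open>d\<close> variables is complex Frechet differentiability at every point of \<open>S\<close>, with
  \<open>\<lambda>v. \<Sum>k=1..d. c k * v k\<close> as the complex-linear derivative at \<open>a\<close>. The definition is meant for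
  sets \<open>S\<close> that are open in \<open>\<complex>\<^sup>d\<close>, such as \<open>Theta m p d\<close>; for those, limits within \<open>S\<close> are
  limits in \<open>\<complex>\<^sup>d\<close>.
\<close>

definition holomorphic_several :: "nat \<Rightarrow> ((nat \<Rightarrow> complex) \<Rightarrow> complex) \<Rightarrow> (nat \<Rightarrow> complex) set \<Rightarrow> bool" where
  "holomorphic_several d f S \<longleftrightarrow>
     (\<forall>a\<in>S. \<exists>c :: nat \<Rightarrow> complex.
        ((\<lambda>z. (f z - f a - (\<Sum>k=1..d. c k * (z k - a k))) /
               complex_of_real (L2_set (\<lambda>k. cmod (z k - a k)) {1..d})) \<longlongrightarrow> 0) (at a within S))"

definition boundary_set :: "nat \<Rightarrow> nat \<Rightarrow> nat \<Rightarrow> (nat \<Rightarrow> complex) set \<Rightarrow> bool" where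
  "boundary_set m p d E \<longleftrightarrow>
     closedin (top_of_set (cl_Theta m p d)) E \<and>
     (\<forall>f. continuous_on (cl_Theta m p d) f \<and> holomorphic_several d f (Theta m p d) \<longrightarrow>
        (\<exists>x\<in>E. \<forall>y\<in>cl_Theta m p d. cmod (f y) \<le> cmod (f x)))"

text \<open>The order on sets is inclusion, so \<open>LEAST\<close> picks the smallest such set.\<close>

definition b_Theta :: "nat \<Rightarrow> nat \<Rightarrow> nat \<Rightarrow> (nat \<Rightarrow> complex) set" where
  "b_Theta m p d = (LEAST E. boundary_set m p d E)"

end

theory Submission
  imports Defs "HOL-Complex_Analysis.Riemann_Mapping"
    "HOL-Computational_Algebra.Fundamental_Theorem_Algebra"
begin

text \<open>
  The point is that the distinguished boundary is the image of the torus,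
  \<open>b_Theta m p d = theta m p d ` ({1..d} \<rightarrow>\<^sub>E sphere 0 1)\<close>. Once this is known, a point of
  \<open>b_Theta m p n\<close> comes from some \<open>w\<close> on the torus, appending the coordinate \<open>\<alpha>\<close> to \<open>w\<close> gives a point of
  the torus in one more dimension, and the recursion
  \<open>esym (Suc d) (Suc i) u = esym d (Suc i) u + u (Suc d) * esym d i u\<close> shows that its image is the
  vector in the theorem. The only care needed is at the top index, where \<open>esym n n\<close> of the \<open>m\<close>-th powers
  is the \<open>p\<close>-th power of the last coordinate of \<open>\<theta>\<close>.

  The image of the torus is a boundary set by the maximum principle (\<open>norm_le_torus\<close>). A point of the
  open polydisc is the centre of an analytic disc whose coordinates are Moebius functions and whose
  boundary lies on the torus, so the maximum principle in one variable suffices.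

  It is the smallest one by a peak function argument. For \<open>w\<close> on the torus with \<open>w k ^ M = 1\<close> for all
  \<open>k\<close>, the product of the \<open>(1 + z k ^ (m * M)) / 2\<close> peaks exactly at a finite set of points of
  \<open>cl_Theta m p d\<close>, and \<open>theta m p d w\<close> is one of them. A high power of this product, multiplied by a
  polynomial that vanishes at the other peak points, forces \<open>theta m p d w\<close> into every boundary set
  (\<open>theta_root_of_unity_in_boundary_set\<close>). The product has to be a polynomial in the coordinates of
  \<open>theta\<close>; instead of the fundamental theorem on symmetric polynomials, it is enough to factor
  \<open>(1 + u ^ M) / 2\<close> into linear factors and to apply Vieta's formula to each of them
  (\<open>prod_poly_factors_theta\<close>). Since roots of unity are dense in the circle and boundary sets are
  closed, the whole image of the torus lies in every boundary set.
\<close>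

section \<open>Convergence and compactness in function spaces\<close>

lemma tendsto_fun_coordinatewise:
  fixes f :: "'b \<Rightarrow> 'a \<Rightarrow> 'c::topological_space"
  assumes "\<And>i. ((\<lambda>x. f x i) \<longlongrightarrow> l i) F"
  shows "(f \<longlongrightarrow> l) F"
proof -
  have "limitin (product_topology (\<lambda>i::'a. euclidean::'c topology) UNIV) f l F"
    using assms by (simp add: limitin_componentwise)
  then show ?thesis
    by (simp add: euclidean_product_topology)
qed

text \<open>
  Outside the index set a member of the dependent product is pinned to \<open>undefined\<close>, a compact
  singleton, so Tychonoff's theorem applies to the product over the whole index type.
\<close>

lemma compact_PiE:
  fixes K :: "'a \<Rightarrow> 'b::topological_space set"
  assumes "\<And>i. i \<in> I \<Longrightarrow> compact (K i)"
  shows "compact (Pi\<^sub>E I K)"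
proof -
  have "Pi\<^sub>E I K = Pi\<^sub>E UNIV (\<lambda>i. if i \<in> I then K i else {undefined})"
    by (auto simp: PiE_iff extensional_def split: if_splits)
  moreover have "compactin (product_topology (\<lambda>i::'a. euclidean::'b topology) UNIV)
      (Pi\<^sub>E UNIV (\<lambda>i. if i \<in> I then K i else {undefined}))"
    unfolding compactin_PiE using assms by simp
  ultimately show ?thesis
    by (simp add: euclidean_product_topology)
qed

section \<open>Moebius functions on the unit circle\<close>

text \<open>
  On the unit circle \<open>1 - cnj z * \<zeta> = \<zeta> * cnj (\<zeta> - z)\<close>, so numerator and denominator of the Moebius
  function have the same modulus. Together with \<open>Moebius_function_norm_lt_1\<close> this makes a tuple of
  Moebius functions an analytic disc in the polydisc with boundary on the torus.
\<close>

lemma cmod_moebius_circle: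
  assumes "cmod z < 1" "cmod \<zeta> = 1"
  shows "cmod (Moebius_function 0 z \<zeta>) = 1"
proof -
  have "cmod (1 - cnj z * \<zeta>) = cmod (cnj \<zeta> * (1 - cnj z * \<zeta>))"
    using assms by (simp add: norm_mult)
  also have "cnj \<zeta> * (1 - cnj z * \<zeta>) = cnj (\<zeta> - z)"
    using assms complex_norm_square[of \<zeta>] by (simp add: algebra_simps)
  finally have e: "cmod (1 - cnj z * \<zeta>) = cmod (\<zeta> - z)"
    by (metis complex_mod_cnj)
  have "\<zeta> \<noteq> z" using assms by auto
  with e show ?thesis
    by (simp add: Moebius_function_simple norm_divide)
qed

section \<open>Elementary symmetric polynomials\<close>

text \<open>
  Vieta's formula. It is what turns symmetric products over the coordinates into functions of
  \<open>theta\<close>.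
\<close>

lemma prod_diff_esym:
  "(\<Prod>k=1..d. a - u k) = (\<Sum>i\<le>d. (-1) ^ i * a ^ (d - i) * esym d i u)"
proof -
  have "(\<Prod>k=1..d. a - u k) =
      (\<Sum>S\<in>Pow {1..d}. (-1) ^ card S * (\<Prod>k\<in>S. u k) * (\<Prod>k\<in>{1..d} - S. a))"
    by (rule prod_diff_conv_sum) simp
  also have "\<dots> = (\<Sum>S\<in>Pow {1..d}. (-1) ^ card S * a ^ (d - card S) * (\<Prod>k\<in>S. u k))"
    by (intro sum.cong refl) (simp add: card_Diff_subset finite_subset[of _ "{1..d}"])
  also have "\<dots> = (\<Sum>i\<in>{..d}. \<Sum>S | S \<in> Pow {1..d} \<and> card S = i.
      (-1) ^ card S * a ^ (d - card S) * (\<Prod>k\<in>S. u k))"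
  proof (rule sum.group [symmetric])
    show "card ` Pow {1..d} \<subseteq> {..d}"
      using card_mono[of "{1..d}"] by fastforce
  qed simp_all
  also have "\<dots> = (\<Sum>i\<le>d. (-1) ^ i * a ^ (d - i) * esym d i u)"
    unfolding esym_def sum_distrib_left by (intro sum.cong) auto
  finally show ?thesis .
qed

lemma esym_0 [simp]: "esym d 0 u = 1"
proof -
  have "{S. S \<subseteq> {1..d} \<and> card S = 0} = {{}}"
    by (auto dest: finite_subset)
  then show ?thesis by (simp add: esym_def)
qed

lemma esym_top: "esym d d u = (\<Prod>k=1..d. u k)"
proof -
  have "{S. S \<subseteq> {1..d} \<and> card S = d} = {{1..d}}"
    using card_subset_eq[of "{1..d}"] by auto
  then show ?thesis by (simp add: esym_def)
qed

text \<open>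
  The subsets of \<open>{1..Suc d}\<close> are split by whether they contain \<open>Suc d\<close>. This recursion is the
  algebraic content of the final theorem.
\<close>

lemma esym_Suc_Suc:
  "esym (Suc d) (Suc i) u = esym d (Suc i) u + u (Suc d) * esym d i u"
proof -
  let ?A = "{S. S \<subseteq> {1..d} \<and> card S = Suc i}"
  let ?B = "{S. S \<subseteq> {1..d} \<and> card S = i}"
  have ins: "card (insert (Suc d) S) = Suc (card S)" if "S \<subseteq> {1..d}" for S
    using that by (subst card_insert_disjoint) (auto dest: finite_subset)
  have split: "{S. S \<subseteq> {1..Suc d} \<and> card S = Suc i} = ?A \<union> insert (Suc d) ` ?B" (is "?L = ?R")
  proof
    show "?R \<subseteq> ?L" using ins by auto
    show "?L \<subseteq> ?R"
    proof
      fix S assume S: "S \<in> ?L"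
      show "S \<in> ?R"
      proof (cases "Suc d \<in> S")
        case False
        then have "S \<subseteq> {1..d}" using S by (auto simp: le_Suc_eq)
        with S show ?thesis by auto
      next
        case True
        have sub: "S - {Suc d} \<subseteq> {1..d}" using S by (auto simp: le_Suc_eq)
        have eq: "insert (Suc d) (S - {Suc d}) = S" using True by auto
        have "card (S - {Suc d}) = i" using ins[OF sub] S eq by simp
        with sub have "insert (Suc d) (S - {Suc d}) \<in> insert (Suc d) ` ?B" by blast
        then show ?thesis unfolding eq by blast
      qed
    qed
  qed
  have notin: "Suc d \<notin> S" if "S \<subseteq> {1..d}" for S
    using that by auto
  have inj: "inj_on (insert (Suc d)) ?B"
    using notin by (intro inj_onI) (metis (mono_tags) insert_ident mem_Collect_eq)
  have fin: "finite ?A" "finite ?B"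
    by (auto intro: finite_subset[of _ "Pow {1..d}"])
  have "esym (Suc d) (Suc i) u = (\<Sum>S\<in>?A. \<Prod>j\<in>S. u j) + (\<Sum>S\<in>insert (Suc d) ` ?B. \<Prod>j\<in>S. u j)"
    unfolding esym_def split using fin by (intro sum.union_disjoint) auto
  also have "(\<Sum>S\<in>insert (Suc d) ` ?B. \<Prod>j\<in>S. u j) = (\<Sum>S\<in>?B. \<Prod>j\<in>insert (Suc d) S. u j)"
    by (rule sum.reindex_cong[OF inj refl refl])
  also have "\<dots> = (\<Sum>S\<in>?B. u (Suc d) * (\<Prod>j\<in>S. u j))"
    using notin by (intro sum.cong refl prod.insert) (auto intro: finite_subset[OF _ finite_atLeastAtMost])
  finally show ?thesis by (simp add: esym_def sum_distrib_left)
qed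

lemma esym_cong: "(\<And>k. k \<in> {1..d} \<Longrightarrow> u k = v k) \<Longrightarrow> esym d i u = esym d i v"
  unfolding esym_def by (intro sum.cong refl prod.cong) auto

section \<open>Polynomials in the coordinates\<close>

text \<open>
  A class of test functions for the maximum condition in \<open>boundary_set\<close>. It contains the
  polynomials in the coordinates \<open>1, \<dots>, d\<close>. Allowing every set \<open>S\<close> makes the closure properties free of side conditions.
\<close>

definition coord_entire :: "nat \<Rightarrow> ((nat \<Rightarrow> complex) \<Rightarrow> complex) \<Rightarrow> bool" where
  "coord_entire d f \<longleftrightarrow> continuous_on UNIV f \<and> (\<forall>S. holomorphic_several d f S)"

lemma coord_entire_const: "coord_entire d (\<lambda>x. c)"
  unfolding coord_entire_def holomorphic_several_def
  by (auto intro!: exI[of _ "\<lambda>_. 0"])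

lemma coord_entire_coord:
  assumes "i \<in> {1..d}"
  shows "coord_entire d (\<lambda>x. x i)"
proof -
  have "(\<Sum>k=1..d. (if k = i then 1 else 0) * (z k - a k)) = z i - a i" for z a :: "nat \<Rightarrow> complex"
    using assms by (simp add: if_distrib[of "\<lambda>t. t * _"] cong: if_cong)
  then show ?thesis
    unfolding coord_entire_def holomorphic_several_def
    by (auto intro!: exI[of _ "\<lambda>k. if k = i then 1 else 0"])
qed

lemma coord_entire_add:
  assumes "coord_entire d f" "coord_entire d g"
  shows "coord_entire d (\<lambda>x. f x + g x)"
  unfolding coord_entire_def holomorphic_several_def
proof (intro conjI allI ballI)
  show "continuous_on UNIV (\<lambda>x. f x + g x)"
    using assms by (auto simp: coord_entire_def intro!: continuous_on_add)
  fix S and a :: "nat \<Rightarrow> complex" assume a: "a \<in> S"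
  let ?R = "\<lambda>z. complex_of_real (L2_set (\<lambda>k. cmod (z k - a k)) {1..d})"
  obtain c c' where
    c: "((\<lambda>z. (f z - f a - (\<Sum>k=1..d. c k * (z k - a k))) / ?R z) \<longlongrightarrow> 0) (at a within S)" and
    c': "((\<lambda>z. (g z - g a - (\<Sum>k=1..d. c' k * (z k - a k))) / ?R z) \<longlongrightarrow> 0) (at a within S)"
    using assms a unfolding coord_entire_def holomorphic_several_def by blast
  have "((\<lambda>z. (f z + g z - (f a + g a) - (\<Sum>k=1..d. (c k + c' k) * (z k - a k))) / ?R z)
      \<longlongrightarrow> 0) (at a within S)"
    using tendsto_add[OF c c'] unfolding distrib_right sum.distrib
    by (simp add: add_divide_distrib diff_divide_distrib algebra_simps)
  then show "\<exists>c. ((\<lambda>z. (f z + g z - (f a + g a) - (\<Sum>k=1..d. c k * (z k - a k))) / ?R z)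
      \<longlongrightarrow> 0) (at a within S)"
    by (intro exI[of _ "\<lambda>k. c k + c' k"])
qed

text \<open>
  The product rule. The increment of \<open>f * g\<close> minus its linear part is
  \<open>(f z - f a - L z) * g z + f a * (g z - g a - L' z) + L z * (g z - g a)\<close>, where \<open>L\<close> and \<open>L'\<close> are the
  derivatives at \<open>a\<close>. The last term is small relative to the distance because \<open>L\<close> is bounded by it
  and \<open>g\<close> is continuous.
\<close>

lemma coord_entire_mult:
  assumes "coord_entire d f" "coord_entire d g"
  shows "coord_entire d (\<lambda>x. f x * g x)"
  unfolding coord_entire_def holomorphic_several_def
proof (intro conjI allI ballI)
  show "continuous_on UNIV (\<lambda>x. f x * g x)"
    using assms by (auto simp: coord_entire_def intro!: continuous_on_mult)
  fix S and a :: "nat \<Rightarrow> complex" assume a: "a \<in> S"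
  let ?R = "\<lambda>z. L2_set (\<lambda>k. cmod (z k - a k)) {1..d}"
  obtain c c' where
    c: "((\<lambda>z. (f z - f a - (\<Sum>k=1..d. c k * (z k - a k))) / ?R z) \<longlongrightarrow> 0) (at a within S)" and
    c': "((\<lambda>z. (g z - g a - (\<Sum>k=1..d. c' k * (z k - a k))) / ?R z) \<longlongrightarrow> 0) (at a within S)"
    using assms a unfolding coord_entire_def holomorphic_several_def by blast
  define L where "L z = (\<Sum>k=1..d. c k * (z k - a k))" for z
  define L' where "L' z = (\<Sum>k=1..d. c' k * (z k - a k))" for z
  have "continuous_on UNIV g"
    using assms by (simp add: coord_entire_def)
  then have g: "(g \<longlongrightarrow> g a) (at a within S)"
    by (metis continuous_on_def UNIV_I subset_UNIV tendsto_within_subset)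
  have L_le: "cmod (L z / ?R z) \<le> (\<Sum>k=1..d. cmod (c k))" for z
  proof (cases "?R z = 0")
    case False
    then have R: "?R z > 0"
      using L2_set_nonneg[of "\<lambda>k. cmod (z k - a k)" "{1..d}"] by linarith
    have "cmod (L z) \<le> (\<Sum>k=1..d. cmod (c k) * cmod (z k - a k))"
      unfolding L_def by (rule sum_norm_le) (simp add: norm_mult)
    also have "\<dots> \<le> (\<Sum>k=1..d. cmod (c k) * ?R z)"
      by (intro sum_mono mult_left_mono member_le_L2_set) auto
    finally show ?thesis
      using R by (simp add: norm_divide divide_simps sum_distrib_right)
  qed (simp add: sum_nonneg)
  have "((\<lambda>z. (L z / ?R z) * (g z - g a)) \<longlongrightarrow> 0) (at a within S)"
  proof (rule Lim_null_comparison)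
    show "\<forall>\<^sub>F z in at a within S.
        norm ((L z / ?R z) * (g z - g a)) \<le> (\<Sum>k=1..d. cmod (c k)) * cmod (g z - g a)"
      unfolding norm_mult by (intro always_eventually allI mult_right_mono L_le) auto
    show "((\<lambda>z. (\<Sum>k=1..d. cmod (c k)) * cmod (g z - g a)) \<longlongrightarrow> 0) (at a within S)"
      using g by (auto intro!: tendsto_eq_intros)
  qed
  with tendsto_mult[OF c g] tendsto_mult[OF tendsto_const[of "f a"] c']
  have "((\<lambda>z. (f z - f a - L z) / ?R z * g z + f a * ((g z - g a - L' z) / ?R z)
      + (L z / ?R z) * (g z - g a)) \<longlongrightarrow> 0 * g a + f a * 0 + 0) (at a within S)"
    unfolding L_def L'_def by (intro tendsto_add)
  moreover have "(f z - f a - L z) / ?R z * g z + f a * ((g z - g a - L' z) / ?R z)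
      + (L z / ?R z) * (g z - g a)
      = (f z * g z - f a * g a - (\<Sum>k=1..d. (c k * g a + f a * c' k) * (z k - a k))) / ?R z" for z
  proof -
    have "(\<Sum>k=1..d. (c k * g a + f a * c' k) * (z k - a k)) = L z * g a + f a * L' z"
      unfolding L_def L'_def distrib_right sum.distrib
      by (simp add: sum_distrib_left sum_distrib_right mult_ac)
    then show ?thesis
      by (simp add: add_divide_distrib diff_divide_distrib algebra_simps)
  qed
  ultimately have "((\<lambda>z. (f z * g z - f a * g a
      - (\<Sum>k=1..d. (c k * g a + f a * c' k) * (z k - a k))) / ?R z) \<longlongrightarrow> 0) (at a within S)"
    by simp
  then show "\<exists>c. ((\<lambda>z. (f z * g z - f a * g a - (\<Sum>k=1..d. c k * (z k - a k))) / ?R z)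
      \<longlongrightarrow> 0) (at a within S)"
    by (intro exI[of _ "\<lambda>k. c k * g a + f a * c' k"])
qed

lemma coord_entire_power:
  assumes "coord_entire d f" shows "coord_entire d (\<lambda>x. f x ^ n)"
  by (induction n) (auto intro: coord_entire_const coord_entire_mult assms)

lemma coord_entire_sum:
  "finite I \<Longrightarrow> (\<And>i. i \<in> I \<Longrightarrow> coord_entire d (f i)) \<Longrightarrow> coord_entire d (\<lambda>x. \<Sum>i\<in>I. f i x)"
  by (induction I rule: finite_induct) (auto intro: coord_entire_const coord_entire_add)

lemma coord_entire_prod:
  "finite I \<Longrightarrow> (\<And>i. i \<in> I \<Longrightarrow> coord_entire d (f i)) \<Longrightarrow> coord_entire d (\<lambda>x. \<Prod>i\<in>I. f i x)"
  by (induction I rule: finite_induct) (auto intro: coord_entire_const coord_entire_mult)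

section \<open>Holomorphic functions along analytic discs\<close>

text \<open>
  The chain rule along a holomorphic disc in \<open>S\<close>. The points of \<open>S\<close> are required to be
  \<open>undefined\<close> outside \<open>{1..d}\<close>: the distance in \<open>holomorphic_several\<close> only sees the coordinates in
  \<open>{1..d}\<close>, and if two different points had distance zero, the quotient would be \<open>0\<close> by convention
  and say nothing about \<open>f\<close>.
\<close>

lemma holomorphic_several_compose:
  assumes f: "holomorphic_several d f S" and S: "S \<subseteq> {1..d} \<rightarrow>\<^sub>E UNIV" and A: "open A"
    and G: "\<And>k. k \<in> {1..d} \<Longrightarrow> (\<lambda>\<zeta>. G \<zeta> k) holomorphic_on A"
    and GS: "\<And>\<zeta>. \<zeta> \<in> A \<Longrightarrow> G \<zeta> \<in> S"
  shows "(\<lambda>\<zeta>. f (G \<zeta>)) holomorphic_on A"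
  unfolding holomorphic_on_open[OF A]
proof
  fix \<zeta>0 assume \<zeta>0: "\<zeta>0 \<in> A"
  define a where "a = G \<zeta>0"
  define R where "R z = complex_of_real (L2_set (\<lambda>k. cmod (z k - a k)) {1..d})" for z
  obtain c where c: "((\<lambda>z. (f z - f a - (\<Sum>k=1..d. c k * (z k - a k))) / R z) \<longlongrightarrow> 0) (at a within S)"
    using f GS[OF \<zeta>0] unfolding holomorphic_several_def R_def a_def by blast
  define e where "e z = (f z - f a - (\<Sum>k=1..d. c k * (z k - a k))) / R z" for z
  have near: "\<forall>\<^sub>F \<zeta> in at \<zeta>0. \<zeta> \<in> A"
    using A \<zeta>0 by (simp add: eventually_at_in_open')
  have D: "((\<lambda>\<zeta>. (G \<zeta> k - a k) / (\<zeta> - \<zeta>0)) \<longlongrightarrow> deriv (\<lambda>\<zeta>. G \<zeta> k) \<zeta>0) (at \<zeta>0)" if "k \<in> {1..d}" for k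
    using holomorphic_derivI[OF G[OF that] A \<zeta>0] unfolding has_field_derivative_iff a_def .
  have "(G \<longlongrightarrow> a) (at \<zeta>0)"
  proof (rule tendsto_fun_coordinatewise)
    fix k
    show "((\<lambda>\<zeta>. G \<zeta> k) \<longlongrightarrow> a k) (at \<zeta>0)"
    proof (cases "k \<in> {1..d}")
      case True
      have "continuous (at \<zeta>0) (\<lambda>\<zeta>. G \<zeta> k)"
        using holomorphic_on_imp_continuous_on[OF G[OF True]] A \<zeta>0
        by (simp add: continuous_on_eq_continuous_at)
      then show ?thesis
        by (simp add: a_def continuous_at)
    next
      case False
      have "G \<zeta> k = undefined" if "\<zeta> \<in> A" for \<zeta>
        using GS[OF that] S False by (auto simp: PiE_iff extensional_def)
      then show ?thesis
        unfolding a_def using near \<zeta>0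
        by (intro tendsto_eventually) (auto elim: eventually_mono)
    qed
  qed
  \<comment> \<open>Since \<open>e a = 0\<close>, the limit at \<open>a\<close> may include \<open>a\<close> itself; \<open>G\<close> may return to \<open>a\<close> near \<open>\<zeta>0\<close>.\<close>
  moreover have "continuous (at a within S) e"
    using c by (simp add: continuous_within e_def[abs_def])
  ultimately have "((\<lambda>\<zeta>. e (G \<zeta>)) \<longlongrightarrow> e a) (at \<zeta>0)"
    using near GS by (intro continuous_within_tendsto_compose[of a S e]) (auto elim: eventually_mono)
  then have e: "((\<lambda>\<zeta>. e (G \<zeta>)) \<longlongrightarrow> 0) (at \<zeta>0)"
    by (simp add: e_def)
  have quot: "(f (G \<zeta>) - f a) / (\<zeta> - \<zeta>0)
      = (\<Sum>k=1..d. c k * ((G \<zeta> k - a k) / (\<zeta> - \<zeta>0))) + e (G \<zeta>) * (R (G \<zeta>) / (\<zeta> - \<zeta>0))"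
    if "\<zeta> \<in> A" for \<zeta>
  proof (cases "R (G \<zeta>) = 0")
    case True
    then have eq: "G \<zeta> k = a k" if "k \<in> {1..d}" for k
      using that by (auto simp: R_def L2_set_eq_0_iff)
    then have "G \<zeta> = a"
      using GS[OF \<open>\<zeta> \<in> A\<close>] GS[OF \<zeta>0] S by (intro PiE_ext[of _ "{1..d}" "\<lambda>_. UNIV"]) (auto simp: a_def)
    then show ?thesis using True by simp
  next
    case False
    then have "e (G \<zeta>) * R (G \<zeta>) = f (G \<zeta>) - f a - (\<Sum>k=1..d. c k * (G \<zeta> k - a k))"
      by (simp add: e_def)
    then have "f (G \<zeta>) - f a = (\<Sum>k=1..d. c k * (G \<zeta> k - a k)) + e (G \<zeta>) * R (G \<zeta>)"
      by simp
    then show ?thesis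
      by (simp add: add_divide_distrib sum_divide_distrib)
  qed
  have R: "cmod (R (G \<zeta>) / (\<zeta> - \<zeta>0)) = L2_set (\<lambda>k. cmod ((G \<zeta> k - a k) / (\<zeta> - \<zeta>0))) {1..d}" for \<zeta>
  proof -
    have "cmod (R (G \<zeta>) / (\<zeta> - \<zeta>0)) = L2_set (\<lambda>k. cmod (G \<zeta> k - a k)) {1..d} * inverse (cmod (\<zeta> - \<zeta>0))"
      unfolding R_def norm_divide norm_of_real by (simp add: L2_set_nonneg divide_inverse)
    also have "\<dots> = L2_set (\<lambda>k. cmod (G \<zeta> k - a k) * inverse (cmod (\<zeta> - \<zeta>0))) {1..d}"
      by (rule L2_set_left_distrib) simp
    finally show ?thesis
      by (simp only: norm_divide divide_inverse norm_mult norm_inverse)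
  qed
  have "((\<lambda>\<zeta>. cmod (R (G \<zeta>) / (\<zeta> - \<zeta>0)))
      \<longlongrightarrow> L2_set (\<lambda>k. cmod (deriv (\<lambda>\<zeta>. G \<zeta> k) \<zeta>0)) {1..d}) (at \<zeta>0)"
    unfolding R L2_set_def by (intro tendsto_intros D) 
  from tendsto_mult[OF tendsto_norm_zero[OF e] this]
  have "((\<lambda>\<zeta>. e (G \<zeta>) * (R (G \<zeta>) / (\<zeta> - \<zeta>0))) \<longlongrightarrow> 0) (at \<zeta>0)"
    by (intro tendsto_norm_zero_cancel[of "\<lambda>\<zeta>. e (G \<zeta>) * (R (G \<zeta>) / (\<zeta> - \<zeta>0))"])
       (simp only: norm_mult mult_zero_left)
  moreover have "((\<lambda>\<zeta>. \<Sum>k=1..d. c k * ((G \<zeta> k - a k) / (\<zeta> - \<zeta>0)))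
      \<longlongrightarrow> (\<Sum>k=1..d. c k * deriv (\<lambda>\<zeta>. G \<zeta> k) \<zeta>0)) (at \<zeta>0)"
    by (intro tendsto_intros D)
  ultimately have "((\<lambda>\<zeta>. (\<Sum>k=1..d. c k * ((G \<zeta> k - a k) / (\<zeta> - \<zeta>0)))
      + e (G \<zeta>) * (R (G \<zeta>) / (\<zeta> - \<zeta>0)))
      \<longlongrightarrow> (\<Sum>k=1..d. c k * deriv (\<lambda>\<zeta>. G \<zeta> k) \<zeta>0)) (at \<zeta>0)"
    using tendsto_add by fastforce
  then have "((\<lambda>\<zeta>. (f (G \<zeta>) - f a) / (\<zeta> - \<zeta>0))
      \<longlongrightarrow> (\<Sum>k=1..d. c k * deriv (\<lambda>\<zeta>. G \<zeta> k) \<zeta>0)) (at \<zeta>0)"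
    by (rule Lim_transform_eventually) (use near quot in \<open>auto elim!: eventually_mono\<close>)
  then show "\<exists>f'. ((\<lambda>\<zeta>. f (G \<zeta>)) has_field_derivative f') (at \<zeta>0)"
    unfolding has_field_derivative_iff a_def by blast
qed

section \<open>Topology of the symmetrised polydisc\<close>

lemma continuous_on_theta: "continuous_on UNIV (theta m p d)"
proof (rule continuous_on_coordinatewise_then_product)
  fix i
  show "continuous_on UNIV (\<lambda>z. theta m p d z i)"
    by (cases "i \<in> {1..d}"; cases "i < d")
       (auto simp: theta_def esym_def intro!: continuous_intros continuous_on_subset[OF continuous_on_product_coordinates])
qed

lemma theta_mem: "theta m p d z \<in> {1..d} \<rightarrow>\<^sub>E UNIV"
  by (auto simp: theta_def)

lemma Theta_subset: "Theta m p d \<subseteq> {1..d} \<rightarrow>\<^sub>E UNIV"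
  unfolding Theta_def by (intro image_subsetI theta_mem)

lemma compact_theta_PiE:
  "compact K \<Longrightarrow> compact (theta m p d ` ({1..d} \<rightarrow>\<^sub>E K))"
  by (intro compact_continuous_image compact_PiE continuous_on_subset[OF continuous_on_theta]) auto

lemma compact_boundary_set:
  assumes "boundary_set m p d E"
  shows "compact E"
proof (rule closedin_compact)
  show "compact (cl_Theta m p d)"
    unfolding cl_Theta_def by (intro compact_theta_PiE) simp
  show "closedin (top_of_set (cl_Theta m p d)) E"
    using assms by (simp add: boundary_set_def)
qed

section \<open>The maximum principle\<close>

text \<open>
  The maximum principle, reduced to one variable. For \<open>y\<close> in the open polydisc, the disc
  \<open>\<zeta> \<mapsto> (Moebius_function 0 (- y k) \<zeta>)\<^sub>k\<close> has centre \<open>y\<close>, stays in the open polydisc and has its boundary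
  on the torus. So \<open>f\<close>, pulled back to this disc, is bounded at \<open>0\<close> by the values of \<open>f\<close> at images
  of points of the torus. Points \<open>z\<close> of the closed polydisc follow by letting \<open>r \<rightarrow> 1\<close> in \<open>r * z\<close>.
\<close>

lemma norm_le_torus:
  assumes f: "continuous_on (cl_Theta m p d) f" "holomorphic_several d f (Theta m p d)"
    and z: "z \<in> {1..d} \<rightarrow>\<^sub>E cball 0 1"
    and M: "\<And>w. w \<in> {1..d} \<rightarrow>\<^sub>E sphere 0 1 \<Longrightarrow> cmod (f (theta m p d w)) \<le> M"
  shows "cmod (f (theta m p d z)) \<le> M"
proof -
  have cont: "continuous_on T (\<lambda>t. f (theta m p d (h t)))"
    if "continuous_on T h" "\<And>t. t \<in> T \<Longrightarrow> h t \<in> {1..d} \<rightarrow>\<^sub>E cball 0 1"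
    for T :: "'a::topological_space set" and h
  proof (rule continuous_on_compose2[OF f(1)])
    show "continuous_on T (\<lambda>t. theta m p d (h t))"
      by (rule continuous_on_compose2[OF continuous_on_theta that(1)]) simp
    show "(\<lambda>t. theta m p d (h t)) ` T \<subseteq> cl_Theta m p d"
      using that(2) by (auto simp: cl_Theta_def)
  qed
  have inner: "cmod (f (theta m p d y)) \<le> M" if y: "y \<in> {1..d} \<rightarrow>\<^sub>E ball 0 1" for y
  proof -
    have y1: "cmod (- y k) < 1" if "k \<in> {1..d}" for k
      using y that by (auto simp: PiE_iff)
    define G where "G \<zeta> = (\<lambda>k\<in>{1..d}. Moebius_function 0 (- y k) \<zeta>)" for \<zeta>
    have ball: "G \<zeta> \<in> {1..d} \<rightarrow>\<^sub>E ball 0 1" if "\<zeta> \<in> ball 0 1" for \<zeta>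
      using that y1 by (auto simp: G_def intro!: Moebius_function_norm_lt_1)
    have sphere: "G \<zeta> \<in> {1..d} \<rightarrow>\<^sub>E sphere 0 1" if "\<zeta> \<in> sphere 0 1" for \<zeta>
      using that y1 by (auto simp: G_def cmod_moebius_circle)
    have cball: "G \<zeta> \<in> {1..d} \<rightarrow>\<^sub>E cball 0 1" if "\<zeta> \<in> cball 0 1" for \<zeta>
    proof (cases "cmod \<zeta> = 1")
      case True
      then have "G \<zeta> \<in> {1..d} \<rightarrow>\<^sub>E sphere 0 1"
        by (intro sphere) simp
      then show ?thesis
        by (rule subsetD[OF PiE_mono, rotated]) auto
    next
      case False
      then have "G \<zeta> \<in> {1..d} \<rightarrow>\<^sub>E ball 0 1"
        using that by (intro ball) simp
      then show ?thesis
        by (rule subsetD[OF PiE_mono, rotated]) auto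
    qed
    \<comment> \<open>The pole of each Moebius function lies outside the closed disc.\<close>
    have nz: "1 + cnj (y k) * \<zeta> \<noteq> 0" if "k \<in> {1..d}" "cmod \<zeta> \<le> 1" for k \<zeta>
    proof
      assume "1 + cnj (y k) * \<zeta> = 0"
      then have "cmod (cnj (y k) * \<zeta>) = 1"
        by (metis add.commute eq_neg_iff_add_eq_0 norm_minus_cancel norm_one)
      moreover have "cmod (y k) * cmod \<zeta> \<le> cmod (y k) * 1"
        using that by (intro mult_left_mono) auto
      ultimately show False
        using y1[OF that(1)] by (simp add: norm_mult)
    qed
    have hol: "(\<lambda>\<zeta>. theta m p d (G \<zeta>) k) holomorphic_on ball 0 1" if k: "k \<in> {1..d}" for k
    proof -
      have "(\<lambda>\<zeta>. G \<zeta> j) holomorphic_on ball 0 1" if "j \<in> {1..d}" for j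
        using Moebius_function_holomorphic[OF y1[OF that]] that by (simp add: G_def)
      then show ?thesis
        using k unfolding theta_def
        by (cases "k < d") (auto simp: esym_def intro!: holomorphic_intros)
    qed
    have "cmod (f (theta m p d (G 0))) \<le> M"
    proof (rule maximum_modulus_frontier[of "\<lambda>\<zeta>. f (theta m p d (G \<zeta>))" "cball 0 1"])
      show "(\<lambda>\<zeta>. f (theta m p d (G \<zeta>))) holomorphic_on interior (cball 0 1)"
        unfolding interior_cball
      proof (rule holomorphic_several_compose[where G = "\<lambda>\<zeta>. theta m p d (G \<zeta>)", OF f(2) Theta_subset open_ball hol])
        show "theta m p d (G \<zeta>) \<in> Theta m p d" if "\<zeta> \<in> ball 0 1" for \<zeta>
          using ball[OF that] by (simp add: Theta_def)
      qed
      have "continuous_on (cball 0 1) G"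
      proof (rule continuous_on_coordinatewise_then_product)
        fix k
        show "continuous_on (cball 0 1) (\<lambda>\<zeta>. G \<zeta> k)"
          using nz by (cases "k \<in> {1..d}")
            (auto simp: G_def Moebius_function_simple intro!: continuous_intros)
      qed
      then show "continuous_on (closure (cball 0 1)) (\<lambda>\<zeta>. f (theta m p d (G \<zeta>)))"
        using cball by (intro cont) auto
      show "cmod (f (theta m p d (G \<zeta>))) \<le> M" if "\<zeta> \<in> frontier (cball 0 1)" for \<zeta>
        using that sphere by (intro M) (auto simp: frontier_cball)
    qed auto
    moreover have "G 0 = y"
      using y by (auto simp: G_def Moebius_function_simple PiE_iff extensional_def)
    ultimately show ?thesis by simp
  qed
  define h where "h r = (\<lambda>k\<in>{1..d}. complex_of_real r * z k)" for r
  have z1: "cmod (z k) \<le> 1" if "k \<in> {1..d}" for k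
    using z that by (auto simp: PiE_iff)
  have "cmod (f (theta m p d (h 1))) \<le> M"
  proof (rule continuous_le_on_closure[of "{0..<1}" "\<lambda>r. cmod (f (theta m p d (h r)))" 1])
    have h: "h r \<in> {1..d} \<rightarrow>\<^sub>E cball 0 1" if "r \<in> {0..1}" for r
      using that z1 by (auto simp: h_def norm_mult intro!: mult_le_one)
    have "continuous_on {0..1} h"
    proof (rule continuous_on_coordinatewise_then_product)
      show "continuous_on {0..1} (\<lambda>r. h r k)" for k
        by (cases "k \<in> {1..d}") (auto simp: h_def intro!: continuous_intros)
    qed
    from continuous_on_norm[OF cont[OF this h]]
    show "continuous_on (closure {0..<1}) (\<lambda>r. cmod (f (theta m p d (h r))))"
      by simp
    fix r :: real assume r: "r \<in> {0..<1}"
    have "r * cmod (z k) < 1" if "k \<in> {1..d}" for k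
      using r mult_left_le[OF z1[OF that], of r] by auto
    then have "h r \<in> {1..d} \<rightarrow>\<^sub>E ball 0 1"
      using r by (auto simp: h_def norm_mult)
    then show "cmod (f (theta m p d (h r))) \<le> M"
      by (rule inner)
  qed simp
  moreover have "h 1 = z"
    using z by (auto simp: h_def PiE_iff extensional_def)
  ultimately show ?thesis by simp
qed

lemma boundary_set_torus: "boundary_set m p d (theta m p d ` ({1..d} \<rightarrow>\<^sub>E sphere 0 1))"
  unfolding boundary_set_def
proof (intro conjI allI impI)
  let ?B = "theta m p d ` ({1..d} \<rightarrow>\<^sub>E sphere 0 1)"
  have sub: "?B \<subseteq> cl_Theta m p d"
    unfolding cl_Theta_def by (intro image_mono PiE_mono) auto
  have B: "compact ?B" by (intro compact_theta_PiE) simp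
  have "(\<lambda>k\<in>{1..d}. 1) \<in> {1..d} \<rightarrow>\<^sub>E sphere (0::complex) 1"
    by auto
  then have ne: "?B \<noteq> {}" by blast
  show "closedin (top_of_set (cl_Theta m p d)) ?B"
    by (intro closed_subset sub compact_imp_closed B)
  fix f assume f: "continuous_on (cl_Theta m p d) f \<and> holomorphic_several d f (Theta m p d)"
  then have "continuous_on ?B (\<lambda>x. cmod (f x))"
    by (intro continuous_on_norm continuous_on_subset[OF _ sub]) blast
  from continuous_attains_sup[OF B ne this]
  obtain x where x: "x \<in> ?B" "\<And>y. y \<in> ?B \<Longrightarrow> cmod (f y) \<le> cmod (f x)"
    by blast
  show "\<exists>x\<in>?B. \<forall>y\<in>cl_Theta m p d. cmod (f y) \<le> cmod (f x)"
  proof (intro bexI ballI)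
    fix y assume "y \<in> cl_Theta m p d"
    then obtain z where "y = theta m p d z" "z \<in> {1..d} \<rightarrow>\<^sub>E cball 0 1"
      by (auto simp: cl_Theta_def)
    then show "cmod (f y) \<le> cmod (f x)"
      using norm_le_torus[of m p d f z "cmod (f x)"] f x(2) by blast
  qed fact
qed

section \<open>Functions of the symmetrised coordinates\<close>

text \<open>
  All elementary symmetric functions of the powers \<open>z k ^ m\<close> are visible in \<open>theta\<close>. For \<open>i = d\<close> this
  uses that the exponent \<open>m div p\<close> of the last coordinate, multiplied by \<open>p\<close>, gives \<open>m\<close>.
\<close>

lemma theta_esym:
  assumes "p dvd m" "0 < p" "i \<in> {1..d}"
  shows "esym d i (\<lambda>k. z k ^ m) = (if i < d then theta m p d z i else theta m p d z d ^ p)"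
proof (cases "i < d")
  case False
  then have "i = d" using assms by simp
  moreover have "(m div p) * p = m" using assms by simp
  ultimately show ?thesis
    using assms(3) by (simp add: theta_def esym_top prod_power_distrib flip: power_mult)
qed (use assms in \<open>simp add: theta_def\<close>)

text \<open>
  For a linear polynomial this is Vieta's formula, read with the coordinates of \<open>theta\<close> in place of
  the elementary symmetric functions. Any other polynomial is a product of linear ones, by the
  fundamental theorem of algebra, and the assertion is multiplicative in \<open>q\<close>.
\<close>

lemma prod_poly_factors_theta:
  assumes "0 < p" "p dvd m"
  shows "\<exists>F. coord_entire d F \<and> (\<forall>z. F (theta m p d z) = (\<Prod>k=1..d. poly q (z k ^ m)))"
proof -
  have lin: "\<exists>F. coord_entire d F \<and> (\<forall>z. F (theta m p d z) = (\<Prod>k=1..d. poly [:- a, 1:] (z k ^ m)))" for a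
  proof -
    define s where "s i x = (if i = 0 then 1 else if i < d then x i else x d ^ p)" for i and x :: "nat \<Rightarrow> complex"
    define F where "F x = (\<Prod>k=1..d. -1) * (\<Sum>i\<le>d. (- 1) ^ i * a ^ (d - i) * s i x)" for x
    have "coord_entire d (s i)" if "i \<le> d" for i
      using that unfolding s_def
      by (cases "i = 0"; cases "i < d")
         (auto intro!: coord_entire_const coord_entire_power[of d "\<lambda>x. x d" p] coord_entire_coord)
    then have "coord_entire d F"
      unfolding F_def by (intro coord_entire_mult coord_entire_sum coord_entire_const) auto
    moreover have "F (theta m p d z) = (\<Prod>k=1..d. poly [:- a, 1:] (z k ^ m))" for z
    proof -
      have "s i (theta m p d z) = esym d i (\<lambda>k. z k ^ m)" if "i \<le> d" for i
        using that theta_esym[OF assms(2,1), of i d z] by (cases "i = 0") (auto simp: s_def)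
      then have "F (theta m p d z) = (\<Prod>k=1..d. -1) * (\<Prod>k=1..d. a - z k ^ m)"
        unfolding F_def prod_diff_esym by simp
      also have "\<dots> = (\<Prod>k=1..d. - 1 * (a - z k ^ m))"
        by (rule prod.distrib[symmetric])
      finally show ?thesis by (simp add: algebra_simps)
    qed
    ultimately show ?thesis by blast
  qed
  have fac: "\<exists>F. coord_entire d F \<and>
      (\<forall>z. F (theta m p d z) = (\<Prod>k=1..d. poly (\<Prod>a\<in>#A. [:- a, 1:]) (z k ^ m)))" for A
  proof (induction A)
    case empty
    show ?case by (intro exI[of _ "\<lambda>_. 1"]) (simp add: coord_entire_const)
  next
    case (add a A)
    obtain F where F: "coord_entire d F" "\<And>z. F (theta m p d z) = (\<Prod>k=1..d. poly (\<Prod>a\<in>#A. [:- a, 1:]) (z k ^ m))"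
      using add by blast
    obtain H where H: "coord_entire d H"
        "\<And>z. H (theta m p d z) = (\<Prod>k=1..d. poly [:- a, 1:] (z k ^ m))"
      using lin by blast
    have "H (theta m p d z) * F (theta m p d z)
        = (\<Prod>k=1..d. poly (\<Prod>a\<in>#add_mset a A. [:- a, 1:]) (z k ^ m))" for z
      by (simp only: F H image_mset_add_mset prod_mset.add_mset poly_mult prod.distrib)
    with coord_entire_mult[OF H(1) F(1)] show ?case by blast
  qed
  show ?thesis
  proof (cases "q = 0")
    case True
    then show ?thesis by (intro exI[of _ "\<lambda>_. \<Prod>k=1..d. 0"]) (simp add: coord_entire_const)
  next
    case False
    obtain A where "size A = degree q \<and> q = smult (lead_coeff q) (\<Prod>a\<in>#A. [:- a, 1:])"
      using alg_closed_imp_factorization[OF False] ..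
    then have A: "q = smult (lead_coeff q) (\<Prod>a\<in>#A. [:- a, 1:])" ..
    obtain F where F: "coord_entire d F" "\<And>z. F (theta m p d z) = (\<Prod>k=1..d. poly (\<Prod>a\<in>#A. [:- a, 1:]) (z k ^ m))"
      using fac by blast
    have "(\<Prod>k=1..d. lead_coeff q) * F (theta m p d z)
        = (\<Prod>k=1..d. poly (smult (lead_coeff q) (\<Prod>a\<in>#A. [:- a, 1:])) (z k ^ m))" for z
      by (simp only: F poly_smult prod.distrib)
    with coord_entire_mult[OF coord_entire_const F(1)] show ?thesis
      unfolding A[symmetric] by blast
  qed
qed

text \<open>
  A Lagrange interpolation polynomial: every other point of \<open>F\<close> contributes a factor in a
  coordinate \<open>k y\<close> in which it differs from \<open>x0\<close>.
\<close>

lemma coord_entire_separate: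
  assumes "finite F" "F \<subseteq> {1..d} \<rightarrow>\<^sub>E UNIV" "x0 \<in> {1..d} \<rightarrow>\<^sub>E UNIV"
  shows "\<exists>g. coord_entire d g \<and> g x0 = 1 \<and> (\<forall>y\<in>F - {x0}. g y = 0)"
proof -
  have "\<exists>k\<in>{1..d}. y k \<noteq> x0 k" if "y \<in> F - {x0}" for y
    using that assms(2,3) PiE_ext[of y "{1..d}" "\<lambda>_. UNIV" x0] by blast
  then obtain k where k: "\<And>y. y \<in> F - {x0} \<Longrightarrow> k y \<in> {1..d} \<and> y (k y) \<noteq> x0 (k y)"
    by metis
  define g where "g x = (\<Prod>y\<in>F - {x0}. (x (k y) + - y (k y)) * inverse (x0 (k y) - y (k y)))" for x
  have "coord_entire d g"
    unfolding g_def using assms(1) k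
    by (intro coord_entire_prod coord_entire_mult coord_entire_add coord_entire_const coord_entire_coord) auto
  moreover have "g x0 = 1"
    unfolding g_def
  proof (intro prod.neutral ballI)
    fix y assume "y \<in> F - {x0}"
    then have "x0 (k y) - y (k y) \<noteq> 0" using k by force
    then show "(x0 (k y) + - y (k y)) * inverse (x0 (k y) - y (k y)) = 1" by simp
  qed
  moreover have "g y = 0" if "y \<in> F - {x0}" for y
    unfolding g_def using that assms(1) by (intro prod_zero) auto
  ultimately show ?thesis by blast
qed

section \<open>Peak functions and minimality of the torus\<close>

text \<open>
  The function \<open>(1 + v) / 2\<close> is a peak function of the closed unit disc at \<open>1\<close>.
\<close>

lemma cmod_half_eq_1:
  assumes "cmod v \<le> 1"
  shows "cmod ((1 + v) / 2) \<le> 1" and "cmod ((1 + v) / 2) = 1 \<Longrightarrow> v = 1"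
proof -
  show "cmod ((1 + v) / 2) \<le> 1"
    using norm_triangle_ineq[of 1 v] assms by (simp add: norm_divide)
  assume "cmod ((1 + v) / 2) = 1"
  then have "(1 + Re v)\<^sup>2 + (Im v)\<^sup>2 = 4"
    by (simp add: cmod_def power_divide field_simps)
  moreover have "(Re v)\<^sup>2 + (Im v)\<^sup>2 \<le> 1"
    using assms by (simp add: cmod_def)
  ultimately have "Re v \<ge> 1"
    by (simp add: power2_eq_square algebra_simps)
  moreover from this have "(Re v)\<^sup>2 \<ge> 1" by simp
  ultimately have "(Im v)\<^sup>2 \<le> 0"
    using \<open>(Re v)\<^sup>2 + (Im v)\<^sup>2 \<le> 1\<close> by linarith
  then show "v = 1"
    using \<open>Re v \<ge> 1\<close> complex_Re_le_cmod[of v] assms by (intro complex_eqI) auto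
qed

text \<open>
  The function \<open>\<Phi>\<close> with \<open>\<Phi> (theta m p d z) = (\<Prod>k=1..d. (1 + z k ^ (m * M)) / 2)\<close> has modulus at
  most \<open>1\<close> on \<open>cl_Theta m p d\<close>, with equality only at the finitely many images of points whose coordinates are roots of
  unity of order dividing \<open>m * M\<close>, and \<open>theta m p d w\<close> is one of them. Let \<open>g\<close> be a polynomial
  that is \<open>1\<close> there and \<open>0\<close> at the other images. If \<open>theta m p d w\<close> were not in \<open>E\<close>, then \<open>g\<close> would vanish
  at every peak point of \<open>\<Phi>\<close> in \<open>E\<close>, so that for large \<open>N\<close> the modulus of \<open>\<Phi> x ^ N * g x\<close> would be less
  than \<open>1\<close> on \<open>E\<close>. But it is \<open>1\<close> at \<open>theta m p d w\<close>, and its maximum is attained on \<open>E\<close>.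
\<close>

lemma theta_root_of_unity_in_boundary_set:
  assumes "0 < m" "0 < p" "p dvd m" and E: "boundary_set m p d E"
    and w: "w \<in> {1..d} \<rightarrow>\<^sub>E sphere 0 1" and M: "0 < M" "\<And>k. k \<in> {1..d} \<Longrightarrow> w k ^ M = 1"
  shows "theta m p d w \<in> E"
proof (rule ccontr)
  define x0 where "x0 = theta m p d w"
  assume "theta m p d w \<notin> E"
  then have x0: "x0 \<notin> E" by (simp add: x0_def)
  define q :: "complex poly" where "q = [:1/2:] + monom (1/2) M"
  have q: "poly q u = (1 + u ^ M) / 2" for u
    by (simp add: q_def poly_monom add_divide_distrib)
  obtain \<Phi> where \<Phi>: "coord_entire d \<Phi>" "\<And>z. \<Phi> (theta m p d z) = (\<Prod>k=1..d. poly q (z k ^ m))"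
    using prod_poly_factors_theta[OF assms(2,3)] by blast
  define Z where "Z = {1..d} \<rightarrow>\<^sub>E {u::complex. u ^ (m * M) = 1}"
  have "finite Z"
    unfolding Z_def using assms(1) M(1) by (intro finite_PiE finite_roots_unity) auto
  then obtain g where g: "coord_entire d g" "g x0 = 1" "\<And>y. y \<in> theta m p d ` Z - {x0} \<Longrightarrow> g y = 0"
    using coord_entire_separate[of "theta m p d ` Z" d x0] theta_mem by (force simp: x0_def)
  have \<Phi>_le: "cmod (\<Phi> x) \<le> 1" and \<Phi>_peak: "cmod (\<Phi> x) = 1 \<Longrightarrow> x \<in> theta m p d ` Z"
    if x: "x \<in> cl_Theta m p d" for x
  proof -
    obtain z where z: "x = theta m p d z" "z \<in> {1..d} \<rightarrow>\<^sub>E cball 0 1"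
      using x by (auto simp: cl_Theta_def image_iff)
    have v: "cmod ((z k ^ m) ^ M) \<le> 1" if "k \<in> {1..d}" for k
      using z that by (auto simp: PiE_iff norm_power intro!: power_le_one)
    have \<Phi>x: "cmod (\<Phi> x) = (\<Prod>k=1..d. cmod (poly q (z k ^ m)))"
      by (simp add: z \<Phi> prod_norm)
    have le: "cmod (poly q (z k ^ m)) \<le> 1" if "k \<in> {1..d}" for k
      using cmod_half_eq_1(1)[OF v[OF that]] unfolding q .
    then show "cmod (\<Phi> x) \<le> 1"
      unfolding \<Phi>x by (intro prod_le_1) auto
    assume 1: "cmod (\<Phi> x) = 1"
    have "(z k ^ m) ^ M = 1" if k: "k \<in> {1..d}" for k
    proof (rule cmod_half_eq_1(2)[OF v[OF k]], rule antisym)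
      have "1 = cmod (poly q (z k ^ m)) * (\<Prod>j\<in>{1..d} - {k}. cmod (poly q (z j ^ m)))"
        using 1 k unfolding \<Phi>x by (simp add: prod.remove)
      also have "\<dots> \<le> cmod (poly q (z k ^ m)) * 1"
        using le by (intro mult_left_mono prod_le_1) auto
      finally show "1 \<le> cmod ((1 + (z k ^ m) ^ M) / 2)"
        by (simp add: q)
    qed (rule cmod_half_eq_1(1)[OF v[OF k]])
    then have "z \<in> Z"
      using z by (auto simp: Z_def PiE_iff power_mult)
    then show "x \<in> theta m p d ` Z"
      using z by blast
  qed
  have "(w k ^ m) ^ M = 1" if "k \<in> {1..d}" for k
    using M(2)[OF that] by (metis power_mult mult.commute power_one)
  then have \<Phi>x0: "\<Phi> x0 = 1"
    by (simp add: x0_def \<Phi> q)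
  have x0_cl: "x0 \<in> cl_Theta m p d"
    unfolding x0_def cl_Theta_def by (intro imageI subsetD[OF PiE_mono w]) auto
  have E_sub: "E \<subseteq> cl_Theta m p d"
    using E closedin_imp_subset unfolding boundary_set_def by blast
  have "compact E"
    by (rule compact_boundary_set[OF E])
  have cont: "continuous_on S (\<lambda>x. cmod (\<Phi> x))" "continuous_on S (\<lambda>x. cmod (g x))" for S
    using \<Phi>(1) g(1) by (auto simp: coord_entire_def intro!: continuous_on_norm elim: continuous_on_subset)
  \<comment> \<open>Off \<open>E'\<close> the factor \<open>g\<close> is already small; on \<open>E'\<close> there is no peak point of \<open>\<Phi>\<close>.\<close>
  define E' where "E' = {x \<in> E. 1 \<le> cmod (g x)}"
  have "compact E'"
  proof -
    have "E' = E \<inter> {x. 1 \<le> cmod (g x)}" by (auto simp: E'_def)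
    then show ?thesis
      using \<open>compact E\<close> by (auto intro!: compact_Int_closed closed_Collect_le continuous_on_const cont)
  qed
  have small: "\<exists>N. \<forall>x\<in>E'. cmod (\<Phi> x ^ N * g x) < 1"
  proof (cases "E' = {}")
    case False
    obtain x1 where x1: "x1 \<in> E'" "\<And>x. x \<in> E' \<Longrightarrow> cmod (\<Phi> x) \<le> cmod (\<Phi> x1)"
      using continuous_attains_sup[OF \<open>compact E'\<close> False cont(1)] by blast
    obtain x2 where x2: "x2 \<in> E'" "\<And>x. x \<in> E' \<Longrightarrow> cmod (g x) \<le> cmod (g x2)"
      using continuous_attains_sup[OF \<open>compact E'\<close> False cont(2)] by blast
    have "cmod (\<Phi> x1) \<noteq> 1"
    proof
      assume "cmod (\<Phi> x1) = 1"
      then have "x1 \<in> theta m p d ` Z - {x0}"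
        using x1(1) x0 \<Phi>_peak E_sub by (auto simp: E'_def)
      then have "g x1 = 0" by (rule g(3))
      then show False using x1(1) by (simp add: E'_def)
    qed
    moreover have "cmod (\<Phi> x1) \<le> 1"
      using x1(1) E_sub by (intro \<Phi>_le) (auto simp: E'_def)
    ultimately have c: "cmod (\<Phi> x1) < 1" by simp
    have g2: "cmod (g x2) \<ge> 1" using x2(1) by (simp add: E'_def)
    then have "0 < 1 / cmod (g x2)" by auto
    then obtain N where N: "cmod (\<Phi> x1) ^ N < 1 / cmod (g x2)"
      using real_arch_pow_inv c by blast
    have "cmod (\<Phi> x ^ N * g x) < 1" if "x \<in> E'" for x
    proof -
      have "cmod (\<Phi> x ^ N * g x) \<le> cmod (\<Phi> x1) ^ N * cmod (g x2)"
        unfolding norm_mult norm_power using x1(2)[OF that] x2(2)[OF that]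
        by (intro mult_mono power_mono) auto
      also have "\<dots> < 1" using N g2 by (simp add: divide_simps split: if_splits)
      finally show ?thesis .
    qed
    then show ?thesis by blast
  qed simp
  then obtain N where N: "\<And>x. x \<in> E' \<Longrightarrow> cmod (\<Phi> x ^ N * g x) < 1" by blast
  have "coord_entire d (\<lambda>x. \<Phi> x ^ N * g x)"
    by (intro coord_entire_mult coord_entire_power \<Phi> g)
  then have "continuous_on (cl_Theta m p d) (\<lambda>x. \<Phi> x ^ N * g x)"
      "holomorphic_several d (\<lambda>x. \<Phi> x ^ N * g x) (Theta m p d)"
    by (auto simp: coord_entire_def elim: continuous_on_subset)
  then obtain x where x: "x \<in> E"
      "\<And>y. y \<in> cl_Theta m p d \<Longrightarrow> cmod (\<Phi> y ^ N * g y) \<le> cmod (\<Phi> x ^ N * g x)"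
    using E unfolding boundary_set_def by blast
  have "1 \<le> cmod (\<Phi> x ^ N * g x)"
    using x(2)[OF x0_cl] by (simp add: \<Phi>x0 g(2))
  moreover have "cmod (\<Phi> x ^ N * g x) < 1"
  proof (cases "x \<in> E'")
    case False
    then have "cmod (g x) < 1" using x(1) by (simp add: E'_def)
    moreover have "cmod (\<Phi> x ^ N * g x) \<le> 1 * cmod (g x)"
      unfolding norm_mult norm_power using \<Phi>_le[of x] x(1) E_sub
      by (intro mult_right_mono power_le_one) auto
    ultimately show ?thesis by simp
  qed (rule N)
  ultimately show False by linarith
qed

text \<open>
  Points whose coordinates are \<open>M\<close>-th roots of unity for some common \<open>M\<close> are dense in the torus (round each
  angle down to a multiple of \<open>2 * pi / Suc N\<close>), and \<open>E\<close> is closed.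
\<close>

lemma theta_torus_subset_boundary_set:
  assumes "0 < m" "0 < p" "p dvd m" and E: "boundary_set m p d E"
  shows "theta m p d ` ({1..d} \<rightarrow>\<^sub>E sphere 0 1) \<subseteq> E"
proof clarify
  fix w :: "nat \<Rightarrow> complex" assume w: "w \<in> {1..d} \<rightarrow>\<^sub>E sphere 0 1"
  define s where "s k = Arg (w k) / (2 * pi)" for k
  define v where "v N = (\<lambda>k\<in>{1..d}. cis (2 * pi * (of_int \<lfloor>s k * real (Suc N)\<rfloor> / real (Suc N))))" for N
  have "v N k ^ Suc N = 1" if "k \<in> {1..d}" for N k
  proof -
    have "v N k ^ Suc N = cis (real (Suc N) * (2 * pi * (of_int \<lfloor>s k * real (Suc N)\<rfloor> / real (Suc N))))"
      unfolding v_def restrict_apply'[OF that] by (rule Complex.DeMoivre)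
    also have "real (Suc N) * (2 * pi * (of_int \<lfloor>s k * real (Suc N)\<rfloor> / real (Suc N)))
        = 2 * pi * of_int \<lfloor>s k * real (Suc N)\<rfloor>"
      by simp
    also have "cis \<dots> = 1" by (intro cis_multiple_2pi) simp
    finally show ?thesis .
  qed
  then have "theta m p d (v N) \<in> E" for N
    by (intro theta_root_of_unity_in_boundary_set[OF assms, of _ "Suc N"]) (auto simp: v_def)
  moreover have "(\<lambda>N. theta m p d (v N)) \<longlonglongrightarrow> theta m p d w"
  proof -
    have "v \<longlonglongrightarrow> w"
    proof (rule tendsto_fun_coordinatewise)
      fix k
      show "(\<lambda>N. v N k) \<longlonglongrightarrow> w k"
      proof (cases "k \<in> {1..d}")
        case True
        have "(\<lambda>N. of_int \<lfloor>s k * real (Suc N)\<rfloor> / real (Suc N)) \<longlonglongrightarrow> s k"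
        proof (rule real_tendsto_sandwich)
          have "s k - 1 / real (Suc N) \<le> of_int \<lfloor>s k * real (Suc N)\<rfloor> / real (Suc N)" for N
          proof -
            have "(s k - 1 / real (Suc N)) * real (Suc N) = s k * real (Suc N) - 1"
              by (simp add: left_diff_distrib del: of_nat_Suc)
            then have "(s k - 1 / real (Suc N)) * real (Suc N) \<le> of_int \<lfloor>s k * real (Suc N)\<rfloor>"
              by linarith
            then show ?thesis
              by (simp only: pos_le_divide_eq of_nat_0_less_iff zero_less_Suc)
          qed
          then show "\<forall>\<^sub>F N in sequentially.
              s k - 1 / real (Suc N) \<le> of_int \<lfloor>s k * real (Suc N)\<rfloor> / real (Suc N)"
            by (intro always_eventually allI)
          have "of_int \<lfloor>s k * real (Suc N)\<rfloor> / real (Suc N) \<le> s k" for N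
            by (simp only: pos_divide_le_eq of_nat_0_less_iff zero_less_Suc of_int_floor_le)
          then show "\<forall>\<^sub>F N in sequentially. of_int \<lfloor>s k * real (Suc N)\<rfloor> / real (Suc N) \<le> s k"
            by (intro always_eventually allI)
          show "(\<lambda>N. s k - 1 / real (Suc N)) \<longlonglongrightarrow> s k"
            using tendsto_diff[OF tendsto_const[of "s k"] LIMSEQ_inverse_real_of_nat]
            by (simp add: inverse_eq_divide)
        qed simp
        then have "(\<lambda>N. cis (2 * pi * (of_int \<lfloor>s k * real (Suc N)\<rfloor> / real (Suc N)))) \<longlonglongrightarrow> cis (2 * pi * s k)"
          by (intro tendsto_cis tendsto_mult_left)
        then have "(\<lambda>N. v N k) \<longlonglongrightarrow> cis (2 * pi * s k)"
          using True by (simp add: v_def)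
        moreover have "cis (2 * pi * s k) = w k"
        proof -
          have "cmod (w k) = 1" using w True by (auto simp: PiE_iff)
          moreover from this have "w k \<noteq> 0" by force
          ultimately show ?thesis using cis_Arg[of "w k"] by (simp add: s_def sgn_div_norm)
        qed
        ultimately show ?thesis by simp
      next
        case False
        then show ?thesis using w by (auto simp: v_def PiE_iff extensional_def)
      qed
    qed
    then show ?thesis
      by (intro continuous_on_tendsto_compose[OF continuous_on_theta, of v w]) simp_all
  qed
  moreover have "closed E"
    by (rule compact_imp_closed[OF compact_boundary_set[OF E]])
  ultimately show "theta m p d w \<in> E"
    using closed_sequentially[of E "\<lambda>N. theta m p d (v N)" "theta m p d w"] by simp
qed

section \<open>The distinguished boundary\<close>

text \<open>
  In particular a smallest boundary set exists, so that \<open>LEAST\<close> in \<open>b_Theta\<close> is meaningful.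
\<close>

lemma b_Theta_eq:
  assumes "0 < m" "0 < p" "p dvd m"
  shows "b_Theta m p d = theta m p d ` ({1..d} \<rightarrow>\<^sub>E sphere 0 1)"
  unfolding b_Theta_def
  by (intro Least_equality boundary_set_torus theta_torus_subset_boundary_set[OF assms])

theorem proposition2p10:
  fixes m p n :: nat and \<theta> :: "nat \<Rightarrow> complex" and \<alpha> :: complex
  assumes "0 < m" and "0 < p" and "p dvd m" and "2 \<le> n"
    and "\<theta> \<in> b_Theta m p n"
    and "\<alpha> \<in> sphere 0 1"
  shows "(\<lambda>i\<in>{1..n+1}.
            if i = 1 then \<alpha> ^ m + \<theta> 1
            else if i < n then \<alpha> ^ m * \<theta> (i - 1) + \<theta> i
            else if i = n then \<alpha> ^ m * \<theta> (n - 1) + \<theta> n ^ p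
            else \<alpha> ^ (m div p) * \<theta> n) \<in> b_Theta m p (n + 1)"
proof -
  obtain w where w: "w \<in> {1..n} \<rightarrow>\<^sub>E sphere 0 1" and \<theta>: "\<theta> = theta m p n w"
    using assms(5) unfolding b_Theta_eq[OF assms(1-3)] by blast
  define w' where "w' = w(Suc n := \<alpha>)"
  have w': "w' \<in> {1..n+1} \<rightarrow>\<^sub>E sphere 0 1"
    using w assms(6) by (auto simp: w'_def PiE_iff extensional_def le_Suc_eq)
  have esym_w': "esym n i (\<lambda>k. w' k ^ m) = esym n i (\<lambda>k. w k ^ m)" for i
    by (rule esym_cong) (auto simp: w'_def)
  have rec: "theta m p (n+1) w' i = esym n i (\<lambda>k. w k ^ m) + \<alpha> ^ m * esym n (i - 1) (\<lambda>k. w k ^ m)"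
    if "i \<in> {1..n}" for i
    using that esym_Suc_Suc[of n "i - 1" "\<lambda>k. w' k ^ m"] esym_w'
    by (simp add: theta_def w'_def)
  have last: "theta m p (n+1) w' (n+1) = \<alpha> ^ (m div p) * \<theta> n"
  proof -
    have "(\<Prod>k=1..n. w' k) = (\<Prod>k=1..n. w k)"
      by (intro prod.cong) (auto simp: w'_def)
    then show ?thesis
      using assms(4) by (simp add: theta_def \<theta> power_mult_distrib) (simp add: w'_def)
  qed
  have eq: "theta m p (n+1) w' = (\<lambda>i\<in>{1..n+1}.
            if i = 1 then \<alpha> ^ m + \<theta> 1
            else if i < n then \<alpha> ^ m * \<theta> (i - 1) + \<theta> i
            else if i = n then \<alpha> ^ m * \<theta> (n - 1) + \<theta> n ^ p
            else \<alpha> ^ (m div p) * \<theta> n)" (is "_ = ?r")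
  proof (rule PiE_ext[of _ "{1..n+1}" "\<lambda>_. UNIV"])
    fix i assume i: "i \<in> {1..n+1}"
    consider "i = n + 1" | "i = 1" | "i \<in> {2..n}" using i by force
    then show "theta m p (n+1) w' i = ?r i"
    proof cases
      case 1
      then show ?thesis using last assms(4) by simp
    next
      case 2
      then show ?thesis
        using rec[of 1] assms(4) theta_esym[OF assms(3,2), of 1 n w] by (simp add: \<theta>)
    next
      case 3
      then have i: "i \<in> {1..n}" "i - 1 \<in> {1..n}" "i - 1 < n" "i \<noteq> 1" "i < n \<or> i = n" by auto
      have "theta m p (n+1) w' i = (if i < n then \<theta> i else \<theta> n ^ p) + \<alpha> ^ m * \<theta> (i - 1)"
        unfolding rec[OF i(1)] theta_esym[OF assms(3,2) i(1)] theta_esym[OF assms(3,2) i(2)] \<theta>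
        using i(3) by (simp only: if_True)
      also have "\<dots> = ?r i"
        using i by (elim disjE) (use assms(4) in \<open>simp_all add: add.commute\<close>)
      finally show ?thesis .
    qed
  qed (rule theta_mem, simp)
  show ?thesis
    unfolding b_Theta_eq[OF assms(1-3)] eq[symmetric] by (intro imageI w')
qed

end
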